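(* If $A$ and $B$ are normal $3 \times 3$ complex matrices, then $AB$ is similar to $BA$.
   Context: $X^*$ denotes the conjugate transpose of a complex matrix $X$. A square complex matrix $X$ is normal if $XX^* = X^*X$. Two $n \times n$ complex matrices $X, Y$ are similar if there is an invertible $n\times n$ complex matrix $S$ with $SX = YS$. *)

theory Defs
  imports "Jordan_Normal_Form.Schur_Decomposition"
begin

definition normal_mat :: "complex mat \<Rightarrow> bool" where
  "normal_mat X \<longleftrightarrow> square_mat X \<and> X * mat_adjoint X = mat_adjoint X * X"

lemma mat_adjoint_eq_conjugate_transpose:
  "mat_adjoint (X :: complex mat) = map_mat cnj (transpose_mat X)"
  unfolding mat_adjoint_def by (rule eq_matI) (auto simp: mat_of_rows_def)

lemma similar_mat_iff_invertible:
  fixes X Y :: "complex mat"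
  assumes X: "X \<in> carrier_mat n n" and Y: "Y \<in> carrier_mat n n"
  shows "similar_mat X Y \<longleftrightarrow> (\<exists>S \<in> carrier_mat n n. invertible_mat S \<and> S * X = Y * S)"
proof
  assume "similar_mat X Y"
  then obtain P Q where w: "similar_mat_wit X Y P Q"
    unfolding similar_mat_def by blast
  note w = similar_mat_witD2[OF X w]
  have "Q * X = Q * (P * (Y * Q))"
    using w by (simp add: assoc_mult_mat[of _ n n _ n _ n])
  also have "\<dots> = (Q * P) * (Y * Q)"
    using w by (intro assoc_mult_mat[symmetric, of _ n n _ n _ n]) auto
  also have "\<dots> = Y * Q"
    using w by simp
  finally have "Q * X = Y * Q" .
  moreover have "invertible_mat Q"
    using w unfolding invertible_mat_def inverts_mat_def by auto
  ultimately show "\<exists>S \<in> carrier_mat n n. invertible_mat S \<and> S * X = Y * S"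
    using w by blast
next
  assume "\<exists>S \<in> carrier_mat n n. invertible_mat S \<and> S * X = Y * S"
  then obtain S T where S: "S \<in> carrier_mat n n" and SX: "S * X = Y * S"
    and ST: "S * T = 1\<^sub>m n" and TS: "T * S = 1\<^sub>m (dim_row T)"
    unfolding invertible_mat_def inverts_mat_def by auto
  have "dim_col T = n"
    using arg_cong[OF ST, of dim_col] by simp
  moreover have "dim_row T = n"
    using arg_cong[OF TS, of dim_col] S by simp
  ultimately have T: "T \<in> carrier_mat n n" and TS: "T * S = 1\<^sub>m n"
    using TS by auto
  have "X = (T * S) * X"
    using X TS by simp
  also have "\<dots> = T * (S * X)"
    using X S T by (intro assoc_mult_mat) auto
  also have "\<dots> = T * Y * S"
    unfolding SX using Y S T by (intro assoc_mult_mat[symmetric]) auto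
  finally show "similar_mat X Y"
    using X Y S T ST TS by (intro similar_matI[of _ _ T S n]) auto
qed

end

theory Submission imports Defs begin

text \<open>
Normality enters only through one fact: \<open>A v = 0\<close> holds exactly when
\<open>A\<^sup>T (conjugate v) = 0\<close> (\<open>normal_kernel_iff\<close>), that is, conjugation matches the right null vectors of a normal
matrix with its left null vectors.

If \<open>A\<close> or \<open>B\<close> is invertible, it conjugates one product into the other. So let both be
singular. In dimension three a singular matrix either has rank at most one, so that it is a
product \<open>x y\<^sup>T\<close>, or its kernel is a line (\<open>kernel_3_cases\<close>). This leaves three
situations.

If \<open>A\<close> or \<open>B\<close> has rank at most one, so have \<open>AB\<close> and \<open>BA\<close>. Any two nonzero
matrices \<open>x y\<^sup>T\<close> with the same trace are similar (\<open>similar_outer\<close>), and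
\<open>AB\<close> and \<open>BA\<close> do have the same trace. Moreover, they vanish simultaneously
(\<open>normal_mult_eq_0\<close>), which is false for arbitrary factors.

Otherwise the kernels are lines, spanned by \<open>v\<close> for \<open>A\<close> and by \<open>u\<close> for \<open>B\<close>.
If these are not orthogonal, then \<open>S = B + v v\<^sup>*\<close> is invertible. Because \<open>A v = 0\<close>
and \<open>v\<^sup>* A = 0\<close>, the added term disappears from both sides of
\<open>S (AB) = (BA) S\<close>, and what remains is \<open>BAB = BAB\<close>
(\<open>oblique_kernels_similar\<close>).

If they are orthogonal, then \<open>v\<close> lies in the range of \<open>B\<close>, which is the orthogonal
complement of \<open>u\<close>. Hence \<open>AB\<close> annihilates both \<open>u\<close> and a preimage of \<open>v\<close>
under \<open>B\<close>, so it has rank at most one; by symmetry so has \<open>BA\<close>, and the argument for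
rank one applies again (\<open>orthogonal_kernels_product_outer\<close>).
\<close>

section \<open>Outer products and traces\<close>

text \<open>This is \<open>x y\<^sup>T\<close> without conjugation, so that the algebra works over any
commutative semiring; the Hermitian version is \<open>outer x (conjugate y)\<close>.\<close>
definition outer :: "'a :: semiring_0 vec \<Rightarrow> 'a vec \<Rightarrow> 'a mat" where
  "outer x y = mat (dim_vec x) (dim_vec y) (\<lambda>(i, j). x $ i * y $ j)"

lemma zero_smult_vec [simp]:
  fixes v :: "'a :: semiring_0 vec"
  shows "v \<in> carrier_vec n \<Longrightarrow> 0 \<cdot>\<^sub>v v = 0\<^sub>v n"
  by (intro eq_vecI) auto

lemma outer_carrier [simp]:
  "x \<in> carrier_vec m \<Longrightarrow> y \<in> carrier_vec n \<Longrightarrow> outer x y \<in> carrier_mat m n"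
  by (auto simp: outer_def)

lemma dim_outer [simp]: "dim_row (outer x y) = dim_vec x" "dim_col (outer x y) = dim_vec y"
  by (simp_all add: outer_def)

lemma mult_outer:
  fixes x y :: "'a :: comm_semiring_0 vec"
  assumes "M \<in> carrier_mat m n" "x \<in> carrier_vec n" "y \<in> carrier_vec k"
  shows "M * outer x y = outer (M *\<^sub>v x) y"
  using assms by (intro eq_matI) (auto simp: outer_def scalar_prod_def sum_distrib_right mult.assoc)

lemma outer_mult:
  fixes x y :: "'a :: comm_semiring_0 vec"
  assumes "M \<in> carrier_mat n k" "x \<in> carrier_vec m" "y \<in> carrier_vec n"
  shows "outer x y * M = outer x (M\<^sup>T *\<^sub>v y)"
  using assms
  by (intro eq_matI) (auto simp: outer_def scalar_prod_def sum_distrib_left mult_ac)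

lemma outer_mult_vec:
  fixes x y :: "'a :: comm_semiring_0 vec"
  assumes "x \<in> carrier_vec m" "y \<in> carrier_vec n" "k \<in> carrier_vec n"
  shows "outer x y *\<^sub>v k = (y \<bullet> k) \<cdot>\<^sub>v x"
  using assms
  by (intro eq_vecI) (auto simp: outer_def scalar_prod_def sum_distrib_left sum_distrib_right mult_ac)

lemma transpose_outer:
  fixes x y :: "'a :: comm_semiring_0 vec"
  shows "(outer x y)\<^sup>T = outer y x"
  by (intro eq_matI) (auto simp: outer_def mult.commute)

lemma outer_zero [simp]:
  assumes "x \<in> carrier_vec m" "y \<in> carrier_vec n"
  shows "outer (0\<^sub>v m) y = 0\<^sub>m m n" "outer x (0\<^sub>v n) = 0\<^sub>m m n"
  using assms by (auto simp: outer_def intro!: eq_matI)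

text \<open>Both sides are traces, since \<open>x y\<^sup>T\<close> has trace \<open>y \<bullet> x\<close>, and
\<open>AB\<close> and \<open>BA\<close> have the same trace.\<close>
lemma trace_outer_eq:
  fixes A B :: "'a :: comm_ring_1 mat"
  assumes "A \<in> carrier_mat n n" "B \<in> carrier_mat n n"
    and "x \<in> carrier_vec n" "y \<in> carrier_vec n" "z \<in> carrier_vec n" "w \<in> carrier_vec n"
    and AB: "A * B = outer x y" and BA: "B * A = outer z w"
  shows "y \<bullet> x = w \<bullet> z"
proof -
  have "y \<bullet> x = (\<Sum>i<n. (A * B) $$ (i, i))"
    using assms(3,4) by (simp add: AB outer_def scalar_prod_def lessThan_atLeast0 mult.commute)
  also have "\<dots> = (\<Sum>i<n. \<Sum>j<n. A $$ (i, j) * B $$ (j, i))"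
    using assms(1,2) by (simp add: scalar_prod_def lessThan_atLeast0)
  also have "\<dots> = (\<Sum>j<n. \<Sum>i<n. B $$ (j, i) * A $$ (i, j))"
    by (subst sum.swap) (simp add: mult.commute)
  also have "\<dots> = (\<Sum>i<n. (B * A) $$ (i, i))"
    using assms(1,2) by (simp add: scalar_prod_def lessThan_atLeast0)
  also have "\<dots> = w \<bullet> z"
    using assms(5,6) by (simp add: BA outer_def scalar_prod_def lessThan_atLeast0 mult.commute)
  finally show ?thesis .
qed

section \<open>Intertwiners\<close>

lemma trivial_kernel_inverse:
  fixes S :: "'a :: field mat"
  assumes S: "S \<in> carrier_mat n n"
    and inj: "\<And>k. k \<in> carrier_vec n \<Longrightarrow> S *\<^sub>v k = 0\<^sub>v n \<Longrightarrow> k = 0\<^sub>v n"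
  obtains T where "T \<in> carrier_mat n n" "S * T = 1\<^sub>m n" "T * S = 1\<^sub>m n"
proof -
  have "det S \<noteq> 0"
    using det_0_iff_vec_prod_zero_field[OF S] inj by blast
  from det_non_zero_imp_unit[OF S this, where b = undefined] show ?thesis
    unfolding Units_def by (auto simp: ring_mat_simps intro: that)
qed

lemma similar_mat_intertwiner:
  fixes S X Y :: "'a :: field mat"
  assumes X: "X \<in> carrier_mat n n" and Y: "Y \<in> carrier_mat n n" and S: "S \<in> carrier_mat n n"
    and SX: "S * X = Y * S"
    and inj: "\<And>k. k \<in> carrier_vec n \<Longrightarrow> S *\<^sub>v k = 0\<^sub>v n \<Longrightarrow> k = 0\<^sub>v n"
  shows "similar_mat X Y"
proof -
  obtain T where T: "T \<in> carrier_mat n n" "S * T = 1\<^sub>m n" "T * S = 1\<^sub>m n"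
    using trivial_kernel_inverse[OF S inj] by blast
  have "X = T * S * X"
    using X T by simp
  also have "\<dots> = T * (Y * S)"
    unfolding SX [symmetric] using X S T by (intro assoc_mult_mat) auto
  also have "\<dots> = T * Y * S"
    using Y S T by (simp add: assoc_mult_mat[of _ n n _ n _ n])
  finally show ?thesis
    using X Y S T by (intro similar_matI[of _ _ T S n]) auto
qed

section \<open>Similarity of rank-one matrices\<close>

text \<open>Two proper hyperplanes never cover the whole space, over any field. Concretely, a
unit vector at a nonzero entry of \<open>x\<close> or of \<open>z\<close> works, or else the sum of the two.\<close>
lemma common_nonorthogonal_vector:
  fixes x z :: "'a :: field vec"
  assumes x: "x \<in> carrier_vec n" "x \<noteq> 0\<^sub>v n" and z: "z \<in> carrier_vec n" "z \<noteq> 0\<^sub>v n"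
  obtains q where "q \<in> carrier_vec n" "q \<bullet> x = 1" "q \<bullet> z \<noteq> 0"
proof -
  obtain i where i: "i < n" "x $ i \<noteq> 0"
    using x by (metis carrier_vecD eq_vecI index_zero_vec)
  obtain j where j: "j < n" "z $ j \<noteq> 0"
    using z by (metis carrier_vecD eq_vecI index_zero_vec)
  have "\<exists>r \<in> carrier_vec n. r \<bullet> x \<noteq> 0 \<and> r \<bullet> z \<noteq> 0"
  proof (cases "z $ i = 0 \<and> x $ j = 0")
    \<comment> \<open>Each unit vector is orthogonal to one of the two vectors, so no cancellation occurs in
      the sum.\<close>
    case True
    then show ?thesis
      using x z i j
      by (intro bexI[of _ "unit_vec n i + unit_vec n j"]) (auto simp: add_scalar_prod_distrib[of _ n])
  next
    case False
    then show ?thesis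
      using x z i j by (metis scalar_prod_left_unit unit_vec_carrier)
  qed
  then obtain r where "r \<in> carrier_vec n" "r \<bullet> x \<noteq> 0" "r \<bullet> z \<noteq> 0"
    by blast
  then show ?thesis
    using x z by (intro that[of "inverse (r \<bullet> x) \<cdot>\<^sub>v r"]) auto
qed

text \<open>The factor \<open>1 + q \<bullet> p\<close> is the determinant of \<open>1 + p q\<^sup>T\<close>.\<close>
lemma transvection_trivial_kernel:
  fixes p q k :: "'a :: field vec"
  assumes "p \<in> carrier_vec n" "q \<in> carrier_vec n" "k \<in> carrier_vec n"
    and "1 + q \<bullet> p \<noteq> 0" and "(1\<^sub>m n + outer p q) *\<^sub>v k = 0\<^sub>v n"
  shows "k = 0\<^sub>v n"
proof -
  have *: "k + (q \<bullet> k) \<cdot>\<^sub>v p = 0\<^sub>v n"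
    using assms by (simp add: add_mult_distrib_mat_vec[of _ n n] outer_mult_vec[of _ n _ n])
  have "(1 + q \<bullet> p) * (q \<bullet> k) = q \<bullet> (k + (q \<bullet> k) \<cdot>\<^sub>v p)"
    using assms by (simp add: scalar_prod_add_distrib[of _ n] algebra_simps)
  also have "\<dots> = 0"
    using assms by (simp add: *)
  finally have "q \<bullet> k = 0"
    using assms by simp
  then show ?thesis
    using * assms by simp
qed

text \<open>If \<open>S x = z\<close> and \<open>S\<^sup>T w = y\<close>, then \<open>S\<close> intertwines
\<open>x y\<^sup>T\<close> and \<open>z w\<^sup>T\<close>. Such an \<open>S\<close> is reached in two steps, each by a
rank-one change of the identity: the first moves \<open>x\<close> to \<open>z\<close> and takes \<open>y\<close> along to
some \<open>y'\<close>; the second fixes \<open>z\<close> and replaces \<open>y'\<close> by \<open>w\<close>. It can fix \<open>z\<close>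
because \<open>y' - w\<close> is orthogonal to \<open>z\<close>, which is what the equality of the traces
says.\<close>
lemma similar_outer:
  fixes x y z w :: "'a :: field vec"
  assumes x: "x \<in> carrier_vec n" "x \<noteq> 0\<^sub>v n" and y: "y \<in> carrier_vec n" "y \<noteq> 0\<^sub>v n"
    and z: "z \<in> carrier_vec n" "z \<noteq> 0\<^sub>v n" and w: "w \<in> carrier_vec n" "w \<noteq> 0\<^sub>v n"
    and tr: "y \<bullet> x = w \<bullet> z"
  shows "similar_mat (outer x y) (outer z w)"
proof -
  obtain q where q: "q \<in> carrier_vec n" "q \<bullet> x = 1" "q \<bullet> z \<noteq> 0"
    using common_nonorthogonal_vector[OF x z] by blast
  \<comment> \<open>\<open>q \<bullet> x = 1\<close> gives \<open>S x = z\<close>, and \<open>q \<bullet> z \<noteq> 0\<close> is the determinant.\<close>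
  define S where "S = 1\<^sub>m n + outer (z - x) q"
  have S: "S \<in> carrier_mat n n"
    using x z q by (simp add: S_def)
  have Sx: "S *\<^sub>v x = z"
    using x z q
    by (simp add: S_def add_mult_distrib_mat_vec[of _ n n] outer_mult_vec[of _ n _ n])
       (intro eq_vecI; simp)
  have S_inj: "k = 0\<^sub>v n" if "k \<in> carrier_vec n" "S *\<^sub>v k = 0\<^sub>v n" for k
    using transvection_trivial_kernel[of "z - x" n q k] that x z q
    by (simp add: S_def scalar_prod_minus_distrib[of _ n])
  obtain T where T: "T \<in> carrier_mat n n" "S * T = 1\<^sub>m n" "T * S = 1\<^sub>m n"
    using trivial_kernel_inverse[OF S S_inj] by blast
  define y' where "y' = T\<^sup>T *\<^sub>v y"
  have y': "y' \<in> carrier_vec n"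
    using T y by (simp add: y'_def)
  have "S\<^sup>T *\<^sub>v y' = (S\<^sup>T * T\<^sup>T) *\<^sub>v y"
    unfolding y'_def using S T y by (intro assoc_mult_mat_vec[symmetric]) auto
  also have "S\<^sup>T * T\<^sup>T = 1\<^sub>m n"
    using transpose_mult[OF T(1) S] T by simp
  finally have Sy': "S\<^sup>T *\<^sub>v y' = y"
    using y by simp
  have y'0: "y' \<noteq> 0\<^sub>v n"
  proof
    assume "y' = 0\<^sub>v n"
    then have "y = S\<^sup>T *\<^sub>v 0\<^sub>v n" using Sy' by simp
    also have "\<dots> = 0\<^sub>v n" using S by (intro eq_vecI) auto
    finally show False using y by simp
  qed
  have tr': "y' \<bullet> z = w \<bullet> z"
    using transpose_vec_mult_scalar[OF S x(1) y'] Sx Sy' tr by simp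
  have 1: "similar_mat (outer x y) (outer z y')"
    using x y z y' S S_inj Sx Sy'
    by (intro similar_mat_intertwiner[of _ n _ S]) (simp_all add: mult_outer[of _ n n _ _ n] outer_mult[of _ n n _ n])
  obtain p where p: "p \<in> carrier_vec n" "p \<bullet> w = 1" "p \<bullet> y' \<noteq> 0"
    using common_nonorthogonal_vector[OF w y' y'0] by blast
  \<comment> \<open>\<open>p \<bullet> w = 1\<close> gives \<open>R\<^sup>T w = y'\<close>, and \<open>p \<bullet> y' \<noteq> 0\<close> is the
    determinant.\<close>
  define R where "R = 1\<^sub>m n + outer p (y' - w)"
  have R: "R \<in> carrier_mat n n"
    using w y' p by (simp add: R_def)
  have Rz: "R *\<^sub>v z = z"
    using w y' p z tr'
    by (simp add: R_def add_mult_distrib_mat_vec[of _ n n] outer_mult_vec[of _ n _ n] minus_scalar_prod_distrib[of _ n])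
  have Rw: "R\<^sup>T *\<^sub>v w = y'"
    using w y' p
    by (simp add: R_def transpose_add[of _ n n] transpose_outer add_mult_distrib_mat_vec[of _ n n] outer_mult_vec[of _ n _ n])
       (intro eq_vecI; simp)
  have R_inj: "k = 0\<^sub>v n" if "k \<in> carrier_vec n" "R *\<^sub>v k = 0\<^sub>v n" for k
    using transvection_trivial_kernel[of p n "y' - w" k] that w y' p
      comm_scalar_prod[of p n w] comm_scalar_prod[of p n y']
    by (simp add: R_def minus_scalar_prod_distrib[of _ n])
  have 2: "similar_mat (outer z y') (outer z w)"
    using z y' w R R_inj Rz Rw
    by (intro similar_mat_intertwiner[of _ n _ R]) (simp_all add: mult_outer[of _ n n _ _ n] outer_mult[of _ n n _ n])
  show ?thesis
    using similar_mat_trans[OF 1 2] .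
qed

section \<open>Singular matrices of size three\<close>

lemma parallel_vec:
  fixes v k :: "'a :: field vec"
  assumes "v \<in> carrier_vec n" "v \<noteq> 0\<^sub>v n" "k \<in> carrier_vec n"
    and par: "\<And>i j. i < n \<Longrightarrow> j < n \<Longrightarrow> v $ i * k $ j = v $ j * k $ i"
  shows "\<exists>c. k = c \<cdot>\<^sub>v v"
proof -
  obtain i where i: "i < n" "v $ i \<noteq> 0"
    using assms(1,2) by (metis carrier_vecD eq_vecI index_zero_vec)
  have "k = (k $ i / v $ i) \<cdot>\<^sub>v v"
    using assms(1,3) i par[OF i(1)] by (intro eq_vecI) (auto simp: field_simps)
  then show ?thesis ..
qed

text \<open>A vector orthogonal to \<open>v\<close> and \<open>k\<close> is parallel to their cross product, because
\<open>r \<times> (v \<times> k) = v (r \<bullet> k) - k (r \<bullet> v)\<close>. It is written out in coordinates, with the cross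
product as \<open>(v1 * k2 - v2 * k1, v2 * k0 - v0 * k2, v0 * k1 - v1 * k0)\<close>.\<close>
lemma orthogonal_pair_cross_product:
  fixes r0 r1 r2 :: "'a :: comm_ring"
  assumes "r0 * v0 + r1 * v1 + r2 * v2 = 0" "r0 * k0 + r1 * k1 + r2 * k2 = 0"
  shows "r0 * (v2 * k0 - v0 * k2) = r1 * (v1 * k2 - v2 * k1)"
    and "r1 * (v0 * k1 - v1 * k0) = r2 * (v2 * k0 - v0 * k2)"
    and "r2 * (v1 * k2 - v2 * k1) = r0 * (v0 * k1 - v1 * k0)"
proof -
  let ?V = "r0 * v0 + r1 * v1 + r2 * v2" and ?K = "r0 * k0 + r1 * k1 + r2 * k2"
  have "r0 * (v2 * k0 - v0 * k2) - r1 * (v1 * k2 - v2 * k1) = v2 * ?K - k2 * ?V"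
    "r1 * (v0 * k1 - v1 * k0) - r2 * (v2 * k0 - v0 * k2) = v0 * ?K - k0 * ?V"
    "r2 * (v1 * k2 - v2 * k1) - r0 * (v0 * k1 - v1 * k0) = v1 * ?K - k1 * ?V"
    by (simp_all add: algebra_simps)
  then show "r0 * (v2 * k0 - v0 * k2) = r1 * (v1 * k2 - v2 * k1)"
    "r1 * (v0 * k1 - v1 * k0) = r2 * (v2 * k0 - v0 * k2)"
    "r2 * (v1 * k2 - v2 * k1) = r0 * (v0 * k1 - v1 * k0)"
    by (simp_all add: assms)
qed

text \<open>If the kernel contains a vector \<open>k\<close> outside the line of \<open>v\<close>, then every row is
orthogonal to both and hence a multiple of the nonzero cross product of \<open>v\<close> and
\<open>k\<close>.\<close>
lemma kernel_3_cases:
  fixes M :: "'a :: field mat"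
  assumes M: "M \<in> carrier_mat 3 3" and v: "v \<in> carrier_vec 3" "v \<noteq> 0\<^sub>v 3" "M *\<^sub>v v = 0\<^sub>v 3"
  obtains (line) "\<And>k. k \<in> carrier_vec 3 \<Longrightarrow> M *\<^sub>v k = 0\<^sub>v 3 \<Longrightarrow> \<exists>c. k = c \<cdot>\<^sub>v v"
    | (outer) x y where "x \<in> carrier_vec 3" "y \<in> carrier_vec 3" "M = outer x y"
proof (cases "\<forall>k \<in> carrier_vec 3. M *\<^sub>v k = 0\<^sub>v 3 \<longrightarrow> (\<exists>c. k = c \<cdot>\<^sub>v v)")
  case True
  then show ?thesis using line by blast
next
  case False
  then obtain k where k: "k \<in> carrier_vec 3" "M *\<^sub>v k = 0\<^sub>v 3" "\<not> (\<exists>c. k = c \<cdot>\<^sub>v v)"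
    by blast
  from parallel_vec[OF v(1,2) k(1)] k(3)
  obtain a b where ab: "a < 3" "b < 3" "v $ a * k $ b \<noteq> v $ b * k $ a"
    by blast
  have row: "M $$ (i, 0) * u $ 0 + M $$ (i, 1) * u $ 1 + M $$ (i, 2) * u $ 2 = 0"
    if "i < 3" "u \<in> carrier_vec 3" "M *\<^sub>v u = 0\<^sub>v 3" for i u
  proof -
    have "(\<Sum>j = 0..<3. M $$ (i, j) * u $ j) = (M *\<^sub>v u) $ i"
      using that(1,2) M by (simp add: scalar_prod_def)
    also have "\<dots> = 0" using that by simp
    finally show ?thesis
      by (simp add: eval_nat_numeral)
  qed
  \<comment> \<open>The cross product of \<open>v\<close> and \<open>k\<close>, with cyclic indices.\<close>
  define c where "c = vec 3 (\<lambda>i. v $ ((i + 1) mod 3) * k $ ((i + 2) mod 3)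
                              - v $ ((i + 2) mod 3) * k $ ((i + 1) mod 3))"
  have lt3: "i < 3 \<longleftrightarrow> i = 0 \<or> i = 1 \<or> i = 2" for i :: nat
    by auto
  have c: "c \<in> carrier_vec 3"
    "c $ 0 = v $ 1 * k $ 2 - v $ 2 * k $ 1"
    "c $ 1 = v $ 2 * k $ 0 - v $ 0 * k $ 2"
    "c $ 2 = v $ 0 * k $ 1 - v $ 1 * k $ 0"
    by (simp_all add: c_def numeral_2_eq_2)
  have "c $ 0 \<noteq> 0 \<or> c $ 1 \<noteq> 0 \<or> c $ 2 \<noteq> 0"
    using ab unfolding lt3 c by (elim disjE) auto
  then obtain d where d: "d < 3" "c $ d \<noteq> 0"
    unfolding lt3 by blast
  have par: "M $$ (i, j) * c $ d = M $$ (i, d) * c $ j" if "i < 3" "j < 3" for i j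
  proof -
    note rows = row[OF that(1) v(1,3)] row[OF that(1) k(1,2)]
    have "M $$ (i, 0) * c $ 1 = M $$ (i, 1) * c $ 0"
      "M $$ (i, 1) * c $ 2 = M $$ (i, 2) * c $ 1"
      "M $$ (i, 2) * c $ 0 = M $$ (i, 0) * c $ 2"
      unfolding c by (rule orthogonal_pair_cross_product[OF rows])+
    then show ?thesis
      using that(2) d(1) unfolding lt3 by (elim disjE) simp_all
  qed
  have "M = outer (vec 3 (\<lambda>i. M $$ (i, d) / c $ d)) c"
    using M c(1) d(2) par by (intro eq_matI) (auto simp: outer_def field_simps)
  then show ?thesis
    using c(1) outer[of "vec 3 (\<lambda>i. M $$ (i, d) / c $ d)" c] by simp
qed

section \<open>Null vectors of normal matrices\<close>

lemma mat_vec_eq_0_imp_zero: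
  fixes M :: "'a :: semiring_1 mat"
  assumes M: "M \<in> carrier_mat m n"
    and zero: "\<And>k. k \<in> carrier_vec n \<Longrightarrow> M *\<^sub>v k = 0\<^sub>v m"
  shows "M = 0\<^sub>m m n"
proof (intro eq_matI)
  fix i j assume ij: "i < dim_row (0\<^sub>m m n :: 'a mat)" "j < dim_col (0\<^sub>m m n :: 'a mat)"
  have "M $$ (i, j) = (M *\<^sub>v unit_vec n j) $ i"
    using M ij by simp
  then show "M $$ (i, j) = 0\<^sub>m m n $$ (i, j)"
    using zero[of "unit_vec n j"] ij by simp
qed (use M in auto)

lemma orthogonal_all_imp_zero:
  fixes v :: "'a :: semiring_1 vec"
  assumes v: "v \<in> carrier_vec n" and zero: "\<And>k. k \<in> carrier_vec n \<Longrightarrow> v \<bullet> k = 0"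
  shows "v = 0\<^sub>v n"
proof (intro eq_vecI)
  fix i assume "i < dim_vec (0\<^sub>v n :: 'a vec)"
  then show "v $ i = 0\<^sub>v n $ i"
    using zero[of "unit_vec n i"] v by simp
qed (use v in simp)

lemma conjugate_sesquilinear_swap:
  fixes a b :: "complex vec"
  assumes "a \<in> carrier_vec n" "b \<in> carrier_vec n"
  shows "conjugate a \<bullet> b = conjugate (conjugate b \<bullet> a)"
  using assms conjugate_sprod_vec[of "conjugate b" n a] comm_scalar_prod[of b n "conjugate a"]
  by simp

lemma conjugate_mult_mat_vec:
  fixes M :: "complex mat"
  assumes "M \<in> carrier_mat m n" "v \<in> carrier_vec n"
  shows "map_mat cnj M *\<^sub>v conjugate v = conjugate (M *\<^sub>v v)"
  using assms by (intro eq_vecI) (auto simp: scalar_prod_def)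

text \<open>Let \<open>H\<close> be the adjoint of \<open>A\<close>. Since \<open>A\<close> and \<open>H\<close> commute, \<open>H v\<close> and
\<open>A v\<close> have the same norm, so they vanish together. The condition on \<open>H v\<close> is
conjugated here, so that it speaks about the transpose and fits the algebra of outer
products.\<close>
lemma normal_kernel_iff:
  assumes A: "A \<in> carrier_mat n n" "normal_mat A" and v: "v \<in> carrier_vec n"
  shows "A *\<^sub>v v = 0\<^sub>v n \<longleftrightarrow> A\<^sup>T *\<^sub>v conjugate v = 0\<^sub>v n"
proof -
  define H where "H = map_mat cnj A\<^sup>T"
  have H: "H \<in> carrier_mat n n" and AH: "A * H = H * A"
    using A by (auto simp: H_def normal_mat_def mat_adjoint_eq_conjugate_transpose)
  have cH: "map_mat cnj H = A\<^sup>T" and HT: "H\<^sup>T = map_mat cnj A"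
    using A by (auto simp: H_def intro!: eq_matI)
  have "(H *\<^sub>v v) \<bullet> conjugate (H *\<^sub>v v) = (H *\<^sub>v v) \<bullet> (A\<^sup>T *\<^sub>v conjugate v)"
    using conjugate_mult_mat_vec[OF H v] by (simp add: cH)
  also have "\<dots> = (A *\<^sub>v (H *\<^sub>v v)) \<bullet> conjugate v"
    using transpose_vec_mult_scalar[of "A\<^sup>T" n n "conjugate v" "H *\<^sub>v v"] A H v by simp
  also have "A *\<^sub>v (H *\<^sub>v v) = H *\<^sub>v (A *\<^sub>v v)"
    using A H v AH by (metis assoc_mult_mat_vec)
  also have "(H *\<^sub>v (A *\<^sub>v v)) \<bullet> conjugate v = (A *\<^sub>v v) \<bullet> (H\<^sup>T *\<^sub>v conjugate v)"
    using transpose_vec_mult_scalar[of "H\<^sup>T" n n "conjugate v" "A *\<^sub>v v"] A H v by simp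
  also have "\<dots> = (A *\<^sub>v v) \<bullet> conjugate (A *\<^sub>v v)"
    using conjugate_mult_mat_vec[OF A(1) v] by (simp add: HT)
  finally have "H *\<^sub>v v = 0\<^sub>v n \<longleftrightarrow> A *\<^sub>v v = 0\<^sub>v n"
    using A H v conjugate_square_eq_0_vec[of "H *\<^sub>v v" n] conjugate_square_eq_0_vec[of "A *\<^sub>v v" n]
    by simp
  moreover have "A\<^sup>T *\<^sub>v conjugate v = conjugate (H *\<^sub>v v)"
    using conjugate_mult_mat_vec[OF H v] by (simp add: cH)
  moreover have "conjugate (H *\<^sub>v v) = 0\<^sub>v n \<longleftrightarrow> H *\<^sub>v v = 0\<^sub>v n"
    by (metis conjugate_cancel_iff conjugate_zero_vec)
  ultimately show ?thesis by simp
qed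

text \<open>\<open>AB = 0\<close> puts the range of \<open>B\<close> into the kernel of \<open>A\<close>, which is that of
the adjoint of \<open>A\<close>; so the ranges of \<open>A\<close> and \<open>B\<close> are orthogonal. Orthogonality is
symmetric, and the same reasoning for \<open>B\<close> leads back to \<open>BA = 0\<close>.\<close>
lemma normal_mult_eq_0:
  assumes A: "A \<in> carrier_mat n n" "normal_mat A" and B: "B \<in> carrier_mat n n" "normal_mat B"
    and AB: "A * B = 0\<^sub>m n n"
  shows "B * A = 0\<^sub>m n n"
proof (rule mat_vec_eq_0_imp_zero)
  fix m :: "complex vec" assume m: "m \<in> carrier_vec n"
  have "B\<^sup>T *\<^sub>v conjugate (A *\<^sub>v m) = 0\<^sub>v n"
  proof (rule orthogonal_all_imp_zero)
    fix k :: "complex vec" assume k: "k \<in> carrier_vec n"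
    have "A *\<^sub>v (B *\<^sub>v k) = A * B *\<^sub>v k"
      using A B k by simp
    also have "\<dots> = 0\<^sub>v n"
      unfolding AB using k by (intro eq_vecI) auto
    finally have "A *\<^sub>v (B *\<^sub>v k) = 0\<^sub>v n" .
    then have ABk: "A\<^sup>T *\<^sub>v conjugate (B *\<^sub>v k) = 0\<^sub>v n"
      using normal_kernel_iff[OF A] B k by simp
    have "(B\<^sup>T *\<^sub>v conjugate (A *\<^sub>v m)) \<bullet> k = conjugate (A *\<^sub>v m) \<bullet> (B *\<^sub>v k)"
      using A B m k by (simp add: transpose_vec_mult_scalar[of _ n n])
    also have "\<dots> = conjugate (conjugate (B *\<^sub>v k) \<bullet> (A *\<^sub>v m))"
      using A B m k by (intro conjugate_sesquilinear_swap[of _ n]) auto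
    also have "conjugate (B *\<^sub>v k) \<bullet> (A *\<^sub>v m) = (A\<^sup>T *\<^sub>v conjugate (B *\<^sub>v k)) \<bullet> m"
      using A B m k by (simp add: transpose_vec_mult_scalar[of _ n n])
    finally show "(B\<^sup>T *\<^sub>v conjugate (A *\<^sub>v m)) \<bullet> k = 0"
      using m by (simp add: ABk)
  qed (use A B m in simp)
  then have "B *\<^sub>v (A *\<^sub>v m) = 0\<^sub>v n"
    using normal_kernel_iff[OF B] A m by simp
  then show "B * A *\<^sub>v m = 0\<^sub>v n"
    using A B m by simp
qed (use A B in simp)

section \<open>Products of rank at most one\<close>

lemma normal_outer_products_similar:
  assumes A: "A \<in> carrier_mat n n" "normal_mat A" and B: "B \<in> carrier_mat n n" "normal_mat B"
    and xy: "x \<in> carrier_vec n" "y \<in> carrier_vec n" "A * B = outer x y"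
    and zw: "z \<in> carrier_vec n" "w \<in> carrier_vec n" "B * A = outer z w"
  shows "similar_mat (A * B) (B * A)"
proof (cases "A * B = 0\<^sub>m n n")
  case True
  then have "B * A = A * B"
    using normal_mult_eq_0[OF A B] by simp
  then show ?thesis
    using A B similar_mat_refl[of "A * B" n] by simp
next
  case False
  then have "B * A \<noteq> 0\<^sub>m n n"
    using normal_mult_eq_0[OF B A] by blast
  with False have "x \<noteq> 0\<^sub>v n" "y \<noteq> 0\<^sub>v n" "z \<noteq> 0\<^sub>v n" "w \<noteq> 0\<^sub>v n"
    using xy zw by auto
  then show ?thesis
    using similar_outer[of x n y z w] trace_outer_eq[OF A(1) B(1) _ _ _ _ xy(3) zw(3)] xy zw
    by simp
qed

lemma normal_outer_similar:
  assumes A: "A \<in> carrier_mat n n" "normal_mat A" and B: "B \<in> carrier_mat n n" "normal_mat B"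
    and xy: "x \<in> carrier_vec n" "y \<in> carrier_vec n" "A = outer x y"
  shows "similar_mat (A * B) (B * A)"
proof (rule normal_outer_products_similar[OF A B])
  show "A * B = outer x (B\<^sup>T *\<^sub>v y)"
    unfolding xy(3) by (rule outer_mult[OF B(1) xy(1,2)])
  show "B * A = outer (B *\<^sub>v x) y"
    unfolding xy(3) by (rule mult_outer[OF B(1) xy(1,2)])
qed (use B xy in auto)

section \<open>Kernels that are lines\<close>

text \<open>If \<open>B k + (v' \<bullet> k) v = 0\<close>, then pairing with the left null vector \<open>u'\<close> removes
the first term and gives \<open>v' \<bullet> k = 0\<close>. So \<open>k\<close> lies in the kernel of \<open>B\<close>, which is
the line of \<open>u\<close>, and \<open>v' \<bullet> u \<noteq> 0\<close> forces \<open>k = 0\<close>.\<close>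
lemma kernel_line_perturbation_trivial_kernel:
  fixes B :: "'a :: field mat"
  assumes B: "B \<in> carrier_mat n n"
    and u: "u \<in> carrier_vec n" "\<And>k. k \<in> carrier_vec n \<Longrightarrow> B *\<^sub>v k = 0\<^sub>v n \<Longrightarrow> \<exists>c. k = c \<cdot>\<^sub>v u"
    and u': "u' \<in> carrier_vec n" "B\<^sup>T *\<^sub>v u' = 0\<^sub>v n"
    and v: "v \<in> carrier_vec n" "v' \<in> carrier_vec n" "u' \<bullet> v \<noteq> 0" "v' \<bullet> u \<noteq> 0"
    and k: "k \<in> carrier_vec n" "(B + outer v v') *\<^sub>v k = 0\<^sub>v n"
  shows "k = 0\<^sub>v n"
proof -
  have *: "B *\<^sub>v k + (v' \<bullet> k) \<cdot>\<^sub>v v = 0\<^sub>v n"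
    using B v k by (simp add: add_mult_distrib_mat_vec[of _ n n] outer_mult_vec[of _ n _ n])
  have "u' \<bullet> (B *\<^sub>v k) = 0"
    using transpose_vec_mult_scalar[OF B k(1) u'(1)] u' k by simp
  then have "(v' \<bullet> k) * (u' \<bullet> v) = u' \<bullet> (B *\<^sub>v k + (v' \<bullet> k) \<cdot>\<^sub>v v)"
    using B u' v k by (simp add: scalar_prod_add_distrib[of _ n])
  also have "\<dots> = 0"
    using u' by (simp add: *)
  finally have v'k: "v' \<bullet> k = 0"
    using v by simp
  have "B *\<^sub>v k = 0\<^sub>v n"
    using * B v k by (simp add: v'k)
  then obtain c where c: "k = c \<cdot>\<^sub>v u"
    using u k by blast
  have "c * (v' \<bullet> u) = 0"
    using v'k v u by (simp add: c)
  then show ?thesis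
    using c u v by simp
qed

text \<open>The intertwiner is \<open>B + v v'\<^sup>T\<close>. The matrix \<open>B\<close> alone already intertwines
\<open>AB\<close> and \<open>BA\<close>, but it is singular; the null vectors of \<open>A\<close> can be added freely to
repair this, as \<open>v'\<^sup>T A\<close> and \<open>A v\<close> both vanish.\<close>
lemma oblique_kernels_similar:
  fixes A B :: "'a :: field mat"
  assumes A: "A \<in> carrier_mat n n" and B: "B \<in> carrier_mat n n"
    and v: "v \<in> carrier_vec n" "A *\<^sub>v v = 0\<^sub>v n"
    and v': "v' \<in> carrier_vec n" "A\<^sup>T *\<^sub>v v' = 0\<^sub>v n"
    and u: "u \<in> carrier_vec n" "\<And>k. k \<in> carrier_vec n \<Longrightarrow> B *\<^sub>v k = 0\<^sub>v n \<Longrightarrow> \<exists>c. k = c \<cdot>\<^sub>v u"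
    and u': "u' \<in> carrier_vec n" "B\<^sup>T *\<^sub>v u' = 0\<^sub>v n"
    and nonorth: "u' \<bullet> v \<noteq> 0" "v' \<bullet> u \<noteq> 0"
  shows "similar_mat (A * B) (B * A)"
proof (rule similar_mat_intertwiner)
  let ?S = "B + outer v v'"
  show "k = 0\<^sub>v n" if "k \<in> carrier_vec n" "?S *\<^sub>v k = 0\<^sub>v n" for k
    using kernel_line_perturbation_trivial_kernel[OF B u u' v(1) v'(1) nonorth] that by blast
  have B0: "B *\<^sub>v 0\<^sub>v n = 0\<^sub>v n" "B\<^sup>T *\<^sub>v 0\<^sub>v n = 0\<^sub>v n"
    using B by (auto intro!: eq_vecI)
  have "(A * B)\<^sup>T *\<^sub>v v' = 0\<^sub>v n" "(B * A) *\<^sub>v v = 0\<^sub>v n"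
    using A B v v' by (simp_all add: transpose_mult[of _ n n _ n] B0)
  then have "outer v v' * (A * B) = 0\<^sub>m n n" "(B * A) * outer v v' = 0\<^sub>m n n"
    using A B v v' by (simp_all add: outer_mult[of _ n n _ n] mult_outer[of _ n n _ _ n])
  then show "?S * (A * B) = (B * A) * ?S"
    using A B v v'
    by (simp add: add_mult_distrib_mat[of _ n n _ _ n] mult_add_distrib_mat[of _ n n _ n]
        assoc_mult_mat[of B n n A n B n])
qed (use A B v v' in auto)

text \<open>On the orthogonal complement of \<open>u\<close>, the invertible matrix
\<open>B + u u\<^sup>*\<close> agrees with \<open>B\<close>. The preimage of \<open>v\<close> under it lies in that
complement, as pairing with the left null vector \<open>u\<^sup>*\<close> of \<open>B\<close> shows.\<close>
lemma normal_orthogonal_kernel_in_range: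
  assumes B: "B \<in> carrier_mat n n" "normal_mat B"
    and u: "u \<in> carrier_vec n" "u \<noteq> 0\<^sub>v n" "B *\<^sub>v u = 0\<^sub>v n"
      "\<And>k. k \<in> carrier_vec n \<Longrightarrow> B *\<^sub>v k = 0\<^sub>v n \<Longrightarrow> \<exists>c. k = c \<cdot>\<^sub>v u"
    and v: "v \<in> carrier_vec n" "conjugate u \<bullet> v = 0"
  obtains m where "m \<in> carrier_vec n" "B *\<^sub>v m = v"
proof -
  let ?u = "conjugate u" and ?S = "B + outer u (conjugate u)"
  have u': "?u \<in> carrier_vec n" "B\<^sup>T *\<^sub>v ?u = 0\<^sub>v n"
    using normal_kernel_iff[OF B u(1)] u by auto
  have uu: "?u \<bullet> u \<noteq> 0"
    using u conjugate_square_eq_0_vec[OF u(1)] comm_scalar_prod[OF u'(1) u(1)] by simp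
  have S: "?S \<in> carrier_mat n n"
    using B u by simp
  obtain T where T: "T \<in> carrier_mat n n" "?S * T = 1\<^sub>m n"
    using trivial_kernel_inverse[OF S] kernel_line_perturbation_trivial_kernel[OF B(1) u(1,4) u' u(1) u'(1) uu uu]
    by blast
  define m where "m = T *\<^sub>v v"
  have m: "m \<in> carrier_vec n"
    using T v by (simp add: m_def)
  have "?S *\<^sub>v m = v"
    using S T v by (simp add: m_def flip: assoc_mult_mat_vec)
  then have *: "B *\<^sub>v m + (?u \<bullet> m) \<cdot>\<^sub>v u = v"
    using B u m by (simp add: add_mult_distrib_mat_vec[of _ n n] outer_mult_vec[of _ n _ n])
  have "?u \<bullet> (B *\<^sub>v m) = 0"
    using transpose_vec_mult_scalar[OF B(1) m u'(1)] u' m by simp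
  then have "(?u \<bullet> m) * (?u \<bullet> u) = ?u \<bullet> (B *\<^sub>v m + (?u \<bullet> m) \<cdot>\<^sub>v u)"
    using B u m by (simp add: scalar_prod_add_distrib[of _ n])
  also have "\<dots> = 0"
    using v by (simp add: *)
  finally have "?u \<bullet> m = 0"
    using uu by simp
  then have "B *\<^sub>v m = v"
    using * B u m by simp
  then show ?thesis
    using that m by blast
qed

text \<open>The kernel of \<open>AB\<close> contains \<open>u\<close> and a preimage of \<open>v\<close> under \<open>B\<close>. They
are not parallel, because \<open>B\<close> kills the first and not the second.\<close>
lemma orthogonal_kernels_product_outer:
  assumes A: "A \<in> carrier_mat 3 3" and B: "B \<in> carrier_mat 3 3" "normal_mat B"
    and v: "v \<in> carrier_vec 3" "v \<noteq> 0\<^sub>v 3" "A *\<^sub>v v = 0\<^sub>v 3"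
    and u: "u \<in> carrier_vec 3" "u \<noteq> 0\<^sub>v 3" "B *\<^sub>v u = 0\<^sub>v 3"
      "\<And>k. k \<in> carrier_vec 3 \<Longrightarrow> B *\<^sub>v k = 0\<^sub>v 3 \<Longrightarrow> \<exists>c. k = c \<cdot>\<^sub>v u"
    and orth: "conjugate u \<bullet> v = 0"
  obtains x y where "x \<in> carrier_vec 3" "y \<in> carrier_vec 3" "A * B = outer x y"
proof -
  obtain m where m: "m \<in> carrier_vec 3" "B *\<^sub>v m = v"
    using normal_orthogonal_kernel_in_range[OF B u v(1) orth] by blast
  have A0: "A *\<^sub>v 0\<^sub>v 3 = 0\<^sub>v 3"
    using A by (auto intro!: eq_vecI)
  have AB: "A * B \<in> carrier_mat 3 3" "A * B *\<^sub>v u = 0\<^sub>v 3" "A * B *\<^sub>v m = 0\<^sub>v 3"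
    using A B u m v A0 by auto
  have m_notin: "m \<noteq> c \<cdot>\<^sub>v u" for c
  proof
    assume "m = c \<cdot>\<^sub>v u"
    then have "v = c \<cdot>\<^sub>v (B *\<^sub>v u)"
      using B u m by (simp add: mult_mat_vec[of _ 3 3])
    then show False
      using u v by (auto intro!: eq_vecI)
  qed
  show ?thesis
    using kernel_3_cases[OF AB(1) u(1,2) AB(2)] m_notin m(1) AB(3) that by metis
qed

section \<open>Products of two normal matrices of size three\<close>

theorem corollary5p2:
  fixes A B :: "complex mat"
  assumes "A \<in> carrier_mat 3 3" and "B \<in> carrier_mat 3 3"
    and "normal_mat A" and "normal_mat B"
  shows "similar_mat (A * B) (B * A)"
proof -
  note A = assms(1,3) and B = assms(2,4)
  have BA_sym: ?thesis if "similar_mat (B * A) (A * B)"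
    using that by (rule similar_mat_sym)
  have invertible: "similar_mat (M * N) (N * M)"
    if "M \<in> carrier_mat 3 3" "N \<in> carrier_mat 3 3"
      "\<And>k. k \<in> carrier_vec 3 \<Longrightarrow> N *\<^sub>v k = 0\<^sub>v 3 \<Longrightarrow> k = 0\<^sub>v 3" for M N :: "complex mat"
    using that by (intro similar_mat_intertwiner[of _ 3 _ N]) (auto simp: assoc_mult_mat[of _ 3 3 _ 3 _ 3])
  show ?thesis
  proof (cases "\<exists>v u. v \<in> carrier_vec 3 \<and> v \<noteq> 0\<^sub>v 3 \<and> A *\<^sub>v v = 0\<^sub>v 3
      \<and> u \<in> carrier_vec 3 \<and> u \<noteq> 0\<^sub>v 3 \<and> B *\<^sub>v u = 0\<^sub>v 3")
    case False
    then show ?thesis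
      using invertible[OF A(1) B(1)] BA_sym[OF invertible[OF B(1) A(1)]] by blast
  next
    case True
    then obtain v u where v: "v \<in> carrier_vec 3" "v \<noteq> 0\<^sub>v 3" "A *\<^sub>v v = 0\<^sub>v 3"
      and u: "u \<in> carrier_vec 3" "u \<noteq> 0\<^sub>v 3" "B *\<^sub>v u = 0\<^sub>v 3" by blast
    show ?thesis
    proof (cases rule: kernel_3_cases[OF A(1) v])
      case (2 x y)
      then show ?thesis using normal_outer_similar[OF A B] by blast
    next
      case A_line: 1
      show ?thesis
      proof (cases rule: kernel_3_cases[OF B(1) u])
        case (2 x y)
        then show ?thesis using BA_sym[OF normal_outer_similar[OF B A]] by blast
      next
        case B_line: 1
        have uv: "conjugate v \<bullet> u = conjugate (conjugate u \<bullet> v)"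
          by (rule conjugate_sesquilinear_swap[OF v(1) u(1)])
        show ?thesis
        proof (cases "conjugate u \<bullet> v = 0")
          case True
          then have vu: "conjugate v \<bullet> u = 0" by (simp add: uv)
          obtain x y where xy: "x \<in> carrier_vec 3" "y \<in> carrier_vec 3" "A * B = outer x y"
            using orthogonal_kernels_product_outer[OF A(1) B v u B_line True] by blast
          obtain z w where zw: "z \<in> carrier_vec 3" "w \<in> carrier_vec 3" "B * A = outer z w"
            using orthogonal_kernels_product_outer[OF B(1) A u v A_line vu] by blast
          show ?thesis
            by (rule normal_outer_products_similar[OF A B xy zw])
        next
          case False
          then have vu: "conjugate v \<bullet> u \<noteq> 0" by (simp add: uv)
          have v': "A\<^sup>T *\<^sub>v conjugate v = 0\<^sub>v 3" and u': "B\<^sup>T *\<^sub>v conjugate u = 0\<^sub>v 3"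
            using normal_kernel_iff[OF A v(1)] normal_kernel_iff[OF B u(1)] u v by blast+
          show ?thesis
            using oblique_kernels_similar[OF A(1) B(1) v(1,3) carrier_vec_conjugate[OF v(1)] v'
                u(1) B_line carrier_vec_conjugate[OF u(1)] u' False vu] .
        qed
      qed
    qed
  qed
qed

end
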